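(* Let $G$ be a connected graph of order $n$ with diameter at most $2$. Let $\lambda_1\ge \lambda_2\ge\cdots\ge\lambda_n$ be the eigenvalues of the adjacency matrix $A(G)$ and let $\partial_1^S\ge\partial_2^S\ge\cdots\ge\partial_n^S$ be the eigenvalues of the distance Seidel matrix $\mathcal{D}^S(G)$. Then for every $1\le r\le n$, $$3-3n+2\lambda_r\le \partial_r^S\le 3+2\lambda_r .$$
   Context: For a connected simple graph $G$ with vertices $v_1,\dots,v_n$, let $d_{rt}=d_G(v_r,v_t)$ be the shortest-path distance and $\mathcal{D}(G)=(d_{rt})$ the distance matrix. The distance Seidel matrix is $\mathcal{D}^S(G)=J-I-2\mathcal{D}(G)$, where $J$ is the $n\times n$ all-ones matrix; i.e. its $(r,t)$ entry is $0$ if $r=t$ and $1-2d_{rt}$ otherwise. Its eigenvalues, in non-increasing order, are denoted $\partial_1^S\ge\cdots\ge\partial_n^S$. *)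

theory Defs
  imports "Graph_Theory.Graph_Theory" "Jordan_Normal_Form.Char_Poly"
begin

text \<open>
  A finite simple graph is a symmetric loop-free digraph without parallel arcs (locale
  \<^locale>\<open>graph\<close>): each undirected edge is a pair of opposite arcs, so the length of a shortest
  directed walk is the usual distance. Distances are extended reals, infinite for vertices in
  different components.
\<close>

definition graph_dist :: "('a, 'b) pre_digraph \<Rightarrow> 'a \<Rightarrow> 'a \<Rightarrow> ereal" where
  "graph_dist G u v = wf_digraph.\<mu> G (\<lambda>_. 1) u v"

definition graph_diameter :: "('a, 'b) pre_digraph \<Rightarrow> ereal" where
  "graph_diameter G = (SUP (u, v) \<in> verts G \<times> verts G. graph_dist G u v)"

text \<open>
  The matrices depend on an enumeration \<open>vs\<close> of the vertices; the vertex called $v_r$ in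
  mathematical notation is \<open>vs ! (r - 1)\<close>, and matrix indices are likewise shifted by one.
\<close>

definition adjacency_matrix :: "('a, 'b) pre_digraph \<Rightarrow> 'a list \<Rightarrow> real mat" where
  "adjacency_matrix G vs =
     mat (length vs) (length vs) (\<lambda>(i, j). if vs ! i \<rightarrow>\<^bsub>G\<^esub> vs ! j then 1 else 0)"

definition distance_matrix :: "('a, 'b) pre_digraph \<Rightarrow> 'a list \<Rightarrow> real mat" where
  "distance_matrix G vs =
     mat (length vs) (length vs) (\<lambda>(i, j). real_of_ereal (graph_dist G (vs ! i) (vs ! j)))"

definition all_ones_matrix :: "nat \<Rightarrow> real mat" where
  "all_ones_matrix n = mat n n (\<lambda>_. 1)"

definition distance_seidel_matrix :: "('a, 'b) pre_digraph \<Rightarrow> 'a list \<Rightarrow> real mat" where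
  "distance_seidel_matrix G vs =
     all_ones_matrix (length vs) - 1\<^sub>m (length vs) - 2 \<cdot>\<^sub>m distance_matrix G vs"

text \<open>
  \<open>eigenvalue_nth M r\<close> is the \<open>r\<close>-th largest real eigenvalue of \<open>M\<close>, counted with algebraic
  multiplicity and starting from \<open>r = 1\<close>. It is meaningful for all $1 \le r \le n$ when \<open>M\<close> is a
  symmetric \<open>n \<times> n\<close> matrix, since then the characteristic polynomial splits over the reals; this is
  the case for the matrices above.
\<close>

definition eigenvalues_desc :: "real mat \<Rightarrow> real list" where
  "eigenvalues_desc M = rev (sorted_list_of_multiset (proots (char_poly M)))"

definition eigenvalue_nth :: "real mat \<Rightarrow> nat \<Rightarrow> real" where
  "eigenvalue_nth M r = eigenvalues_desc M ! (r - 1)"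

end

theory Submission
  imports Defs "Jordan_Normal_Form.Schur_Decomposition"
begin

text \<open>
  If the diameter is at most two, then the distance Seidel matrix equals \<open>3 I - 3 J + 2 A\<close>. Since
  \<open>0 \<le> x \<bullet> J x \<le> n (x \<bullet> x)\<close>, its quadratic form lies between those of \<open>2 A + (3 - 3 n) I\<close> and
  \<open>2 A + 3 I\<close>, and an inequality between quadratic forms carries over to the ordered eigenvalues.
\<close>

section \<open>The spectral theorem for real symmetric matrices\<close>

lemma scalar_prod_mult_mat_vec_sum:
  assumes "A \<in> carrier_mat n n" "x \<in> carrier_vec n" "y \<in> carrier_vec n"
  shows "y \<bullet> (A *\<^sub>v x) = (\<Sum>i<n. \<Sum>j<n. y $ i * (A $$ (i, j) * x $ j))"
  using assms by (auto simp: scalar_prod_def sum_distrib_left atLeast0LessThan intro!: sum.cong)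

text \<open>The Hermitian form \<open>s\<close> of a complex eigenvector \<open>v\<close> is
  \<open>a\<close> times the squared norm \<open>q\<close> of \<open>v\<close>. It equals its own
  conjugate because the matrix is real and symmetric, so \<open>a\<close> is a quotient of two
  reals.\<close>

lemma symmetric_mat_complex_eigenvalue_real:
  fixes A :: "real mat"
  assumes A: "A \<in> carrier_mat n n" and sym: "transpose_mat A = A"
    and ev: "eigenvalue (map_mat complex_of_real A) a"
  shows "a \<in> \<real>"
proof -
  let ?C = "map_mat complex_of_real A"
  obtain v where v: "v \<in> carrier_vec n" "v \<noteq> 0\<^sub>v n" "?C *\<^sub>v v = a \<cdot>\<^sub>v v"
    using ev A unfolding eigenvalue_def eigenvector_def by auto
  have symA: "A $$ (i, j) = A $$ (j, i)" if "i < n" "j < n" for i j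
    using that A by (metis sym carrier_matD index_transpose_mat(1))
  define s where "s = (\<Sum>i<n. \<Sum>j<n. cnj (v $ i) * (of_real (A $$ (i, j)) * v $ j))"
  define q where "q = (\<Sum>i<n. (cmod (v $ i))\<^sup>2)"
  have "s = conjugate v \<bullet> (?C *\<^sub>v v)"
    using A v(1) by (subst scalar_prod_mult_mat_vec_sum[of _ n]) (auto simp: s_def intro!: sum.cong)
  also have "\<dots> = a * (conjugate v \<bullet> v)"
    using v by (simp add: carrier_vec_conjugate)
  also have "conjugate v \<bullet> v = of_real q"
    using v(1) by (auto simp: scalar_prod_def q_def atLeast0LessThan complex_norm_square
        mult.commute[of "cnj _"] simp del: of_real_power intro!: sum.cong)
  finally have s: "s = a * of_real q" .
  \<comment> \<open>Conjugation exchanges the roles of \<open>i\<close> and \<open>j\<close>;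
    swapping the sums and using symmetry of \<open>A\<close> restores \<open>s\<close>.\<close>
  have "cnj s = (\<Sum>i<n. \<Sum>j<n. cnj (v $ j) * (of_real (A $$ (i, j)) * v $ i))"
    by (simp add: s_def mult_ac)
  also have "\<dots> = (\<Sum>j<n. \<Sum>i<n. cnj (v $ j) * (of_real (A $$ (i, j)) * v $ i))"
    by (rule sum.swap)
  also have "\<dots> = s"
    unfolding s_def using symA by (intro sum.cong refl) auto
  finally have "s \<in> \<real>"
    by (simp add: complex_is_Real_iff complex_eq_iff)
  moreover have "q \<noteq> 0"
  proof
    assume "q = 0"
    then have "\<forall>i<n. v $ i = 0"
      unfolding q_def by (subst (asm) sum_nonneg_eq_0_iff) auto
    with v show False
      by (auto intro: eq_vecI)
  qed
  then have "a = s / of_real q"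
    using s by simp
  ultimately show ?thesis
    by simp
qed

text \<open>The characteristic polynomial splits over the complex numbers and all its roots are
  real, so the factorization is the image of a real one. Injectivity of the embedding on polynomials
  pulls it back.\<close>

lemma symmetric_mat_char_poly_splits:
  fixes A :: "real mat"
  assumes A: "A \<in> carrier_mat n n" and sym: "transpose_mat A = A"
  obtains es where "char_poly A = (\<Prod>e\<leftarrow>es. [:- e, 1:])"
proof -
  interpret h: map_poly_inj_idom_hom complex_of_real ..
  let ?C = "map_mat complex_of_real A"
  have C: "?C \<in> carrier_mat n n"
    using A by simp
  obtain as where as: "char_poly ?C = (\<Prod>a\<leftarrow>as. [:- a, 1:])"
    using char_poly_factorized[OF C] by blast
  have "a \<in> \<real>" if "a \<in> set as" for a
  proof -
    have "poly (char_poly ?C) a = 0"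
      unfolding as using linear_poly_root[OF that] .
    then show ?thesis
      using symmetric_mat_complex_eigenvalue_real[OF A sym] eigenvalue_root_char_poly[OF C] by blast
  qed
  then have eq: "[:- a, 1:] = map_poly complex_of_real [:- Re a, 1:]" if "a \<in> set as" for a
    using that by simp
  have "map_poly complex_of_real (char_poly A) = char_poly ?C"
    using A by (simp add: of_real_hom.char_poly_hom)
  also have "\<dots> = (\<Prod>a\<leftarrow>as. map_poly complex_of_real [:- Re a, 1:])"
    unfolding as using eq by (metis (no_types, lifting) map_eq_conv)
  also have "\<dots> = map_poly complex_of_real (\<Prod>e\<leftarrow>map Re as. [:- e, 1:])"
    by (simp add: h.hom_prod_list o_def)
  finally have "char_poly A = (\<Prod>e\<leftarrow>map Re as. [:- e, 1:])"
    by simp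
  then show ?thesis
    by (rule that)
qed

text \<open>Complete \<open>v\<close> to a basis, apply Gram-Schmidt, which keeps the first vector,
  and normalize the result. The factor \<open>c\<close> absorbs the length of
  \<open>v\<close>.\<close>

lemma orthogonal_mat_with_first_col:
  fixes v :: "real vec"
  assumes v: "v \<in> carrier_vec n" "v \<noteq> 0\<^sub>v n"
  obtains W c where "W \<in> carrier_mat n n" "transpose_mat W * W = 1\<^sub>m n" "col W 0 = c \<cdot>\<^sub>v v"
proof -
  interpret cof_vec_space n "TYPE(real)" .
  have n: "0 < n"
    using v by (cases n) auto
  define b where "b = basis_completion v"
  note bc = basis_completion[OF v, folded b_def]
  define ws where "ws = gram_schmidt n b"
  note gs = gram_schmidt_result[OF bc(2) bc(4) bc(5) ws_def]
  obtain vs where "b = v # vs"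
    using bc n by (cases b) auto
  then have hd: "hd ws = v"
    unfolding ws_def using v by simp
  have len: "length ws = n"
    using gs bc by simp
  have ws: "ws ! i \<in> carrier_vec n" if "i < n" for i
    using gs len that by auto
  \<comment> \<open>The case \<open>i = j\<close> of this equivalence says that no
    \<open>ws ! i\<close> has length zero, which the normalization below relies on.\<close>
  have orth: "ws ! i \<bullet> ws ! j = 0 \<longleftrightarrow> i \<noteq> j" if "i < n" "j < n" for i j
    using corthogonalD[OF gs(2)] that len by simp
  define c where "c i = 1 / sqrt (ws ! i \<bullet> ws ! i)" for i
  define W where "W = mat_of_cols n (map (\<lambda>i. c i \<cdot>\<^sub>v ws ! i) [0..<n])"
  have W: "W \<in> carrier_mat n n"
    unfolding W_def using mat_of_cols_carrier(1)[of n "map (\<lambda>i. c i \<cdot>\<^sub>v ws ! i) [0..<n]"] by simp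
  have col: "col W i = c i \<cdot>\<^sub>v ws ! i" if "i < n" for i
    unfolding W_def using that ws by (subst col_mat_of_cols) auto
  have norm: "c i * (c i * (ws ! i \<bullet> ws ! i)) = 1" if "i < n" for i
  proof -
    have "ws ! i \<bullet> ws ! i \<ge> 0"
      using that ws[of i] by (auto simp: scalar_prod_def intro!: sum_nonneg)
    then have "ws ! i \<bullet> ws ! i > 0"
      using orth[OF that that] by simp
    then show ?thesis
      by (simp add: c_def field_simps)
  qed
  have "transpose_mat W * W = 1\<^sub>m n"
  proof (rule eq_matI)
    fix i j
    assume "i < dim_row (1\<^sub>m n :: real mat)" "j < dim_col (1\<^sub>m n :: real mat)"
    then have ij: "i < n" "j < n"
      by auto
    then have "(transpose_mat W * W) $$ (i, j) = c i * (c j * (ws ! i \<bullet> ws ! j))"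
      using W(1) ws by (simp add: col smult_scalar_prod_distrib[of _ n] scalar_prod_smult_distrib[of _ n])
    then show "(transpose_mat W * W) $$ (i, j) = 1\<^sub>m n $$ (i, j)"
      using ij orth norm by simp
  qed (use W in auto)
  moreover have "col W 0 = c 0 \<cdot>\<^sub>v v"
    using n len hd by (metis col hd_conv_nth length_greater_0_conv)
  ultimately show ?thesis
    using W that by blast
qed

text \<open>For a square matrix with orthonormal columns the transpose is a two-sided inverse, so
  this conjugation is a similarity.\<close>

lemma orthogonal_similar_char_poly:
  fixes A :: "real mat"
  assumes A: "A \<in> carrier_mat n n" and W: "W \<in> carrier_mat n n" "transpose_mat W * W = 1\<^sub>m n"
  shows "char_poly (transpose_mat W * A * W) = char_poly A"
proof -
  have "W * transpose_mat W = 1\<^sub>m n"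
    using mat_mult_left_right_inverse[OF _ W(1) W(2)] W(1) by simp
  then have "similar_mat_wit (transpose_mat W * A * W) A (transpose_mat W) W"
    using A W by (intro similar_mat_witI[of _ _ n]) auto
  then show ?thesis
    by (intro char_poly_similar) (auto simp: similar_mat_def)
qed

text \<open>Take an orthogonal \<open>W\<close> whose first column is a multiple of an eigenvector.
  The first column of the conjugated matrix is then \<open>e\<close> times the first unit vector,
  symmetry clears the first row as well, and \<open>B\<close> is the symmetric block that
  remains.\<close>

lemma orthogonal_deflation:
  fixes A :: "real mat"
  assumes A: "A \<in> carrier_mat n n" and sym: "transpose_mat A = A" and ev: "eigenvalue A e"
  obtains W B m where "n = Suc m" "W \<in> carrier_mat n n" "transpose_mat W * W = 1\<^sub>m n"
    "B \<in> carrier_mat m m" "transpose_mat B = B"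
    "transpose_mat W * A * W = four_block_mat (mat 1 1 (\<lambda>_. e)) (0\<^sub>m 1 m) (0\<^sub>m m 1) B"
proof -
  obtain v where v: "v \<in> carrier_vec n" "v \<noteq> 0\<^sub>v n" "A *\<^sub>v v = e \<cdot>\<^sub>v v"
    using ev A unfolding eigenvalue_def eigenvector_def by auto
  obtain m where n: "n = Suc m"
    using v by (cases n) auto
  obtain W c where W: "W \<in> carrier_mat n n" "transpose_mat W * W = 1\<^sub>m n" "col W 0 = c \<cdot>\<^sub>v v"
    using orthogonal_mat_with_first_col v by blast
  define M where "M = transpose_mat W * A * W"
  have M: "M \<in> carrier_mat n n"
    using A W by (simp add: M_def)
  have Msym: "transpose_mat M = M"
    using A W sym by (simp add: M_def transpose_mult[of _ n n _ n] assoc_mult_mat[of _ n n _ n _ n])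
  have M0: "M $$ (i, 0) = (if i = 0 then e else 0)" if "i < n" for i
  proof -
    have "M $$ (i, 0) = col M 0 $ i"
      using M that by simp
    also have "col M 0 = transpose_mat W *\<^sub>v (A *\<^sub>v col W 0)"
    proof -
      have "M = transpose_mat W * (A * W)"
        using A W(1) by (simp add: M_def assoc_mult_mat[of _ n n _ n _ n])
      also have "col \<dots> 0 = transpose_mat W *\<^sub>v col (A * W) 0"
        using A W(1) n by (intro col_mult2[of _ n n _ n]) auto
      also have "col (A * W) 0 = A *\<^sub>v col W 0"
        using A W(1) n by (intro col_mult2[of _ n n _ n]) auto
      finally show ?thesis .
    qed
    also have "A *\<^sub>v col W 0 = e \<cdot>\<^sub>v col W 0"
      using A v by (simp add: W(3) mult_mat_vec[of _ n n] smult_smult_assoc mult.commute)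
    also have "transpose_mat W *\<^sub>v (e \<cdot>\<^sub>v col W 0) = e \<cdot>\<^sub>v col (transpose_mat W * W) 0"
    proof -
      have "transpose_mat W *\<^sub>v col W 0 = col (transpose_mat W * W) 0"
        using W(1) n by (intro col_mult2[of _ n n _ n, symmetric]) auto
      moreover have "col W 0 \<in> carrier_vec n"
        using W(1) by auto
      ultimately show ?thesis
        using W(1) mult_mat_vec[of "transpose_mat W" n n "col W 0" e] by simp
    qed
    finally show ?thesis
      using that W(2) by simp
  qed
  have M0': "M $$ (0, i) = (if i = 0 then e else 0)" if "i < n" for i
    using M0[OF that] M n that by (metis Msym carrier_matD index_transpose_mat(1) zero_less_Suc)
  define B where "B = mat m m (\<lambda>(i, j). M $$ (Suc i, Suc j))"
  have "M $$ (Suc i, Suc j) = M $$ (Suc j, Suc i)" if "i < m" "j < m" for i j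
    using M n that by (metis Msym Suc_less_eq carrier_matD index_transpose_mat(1))
  then have "transpose_mat B = B"
    by (auto simp: B_def)
  moreover have "M = four_block_mat (mat 1 1 (\<lambda>_. e)) (0\<^sub>m 1 m) (0\<^sub>m m 1) B"
    using M n M0 M0' by (intro eq_matI) (auto simp: B_def)
  moreover have "B \<in> carrier_mat m m"
    by (simp add: B_def)
  ultimately show ?thesis
    using that[OF n W(1,2)] unfolding M_def by blast
qed

text \<open>Induction on \<open>es\<close>, splitting off the eigenvalue at its head by deflation.
  Any list of the roots is allowed, so the order of the diagonal can be prescribed; later it is the
  descending one.\<close>

theorem real_symmetric_spectral:
  fixes A :: "real mat"
  assumes "A \<in> carrier_mat n n" and "transpose_mat A = A"
    and "char_poly A = (\<Prod>e\<leftarrow>es. [:- e, 1:])"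
  shows "\<exists>P \<in> carrier_mat n n. transpose_mat P * P = 1\<^sub>m n \<and>
    transpose_mat P * A * P = mat_diag n ((!) es)"
  using assms
proof (induction es arbitrary: n A)
  case Nil
  \<comment> \<open>The degree of the characteristic polynomial is the size of the matrix.\<close>
  then have "n = 0"
    using degree_monic_char_poly[of A n] by simp
  with Nil.prems(1) show ?case
    by (intro bexI[of _ "1\<^sub>m 0"] conjI eq_matI) (auto simp: mat_diag_def)
next
  case (Cons e es)
  note A = Cons.prems(1)
  have "eigenvalue A e"
    unfolding eigenvalue_root_char_poly[OF A] Cons.prems(3) by simp
  from orthogonal_deflation[OF A Cons.prems(2) this]
  obtain W B m where n: "n = Suc m" and W: "W \<in> carrier_mat n n" "transpose_mat W * W = 1\<^sub>m n"
    and B: "B \<in> carrier_mat m m" "transpose_mat B = B"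
    and WAW: "transpose_mat W * A * W = four_block_mat (mat 1 1 (\<lambda>_. e)) (0\<^sub>m 1 m) (0\<^sub>m m 1) B"
    by blast
  let ?E = "mat 1 1 (\<lambda>_. e)"
  \<comment> \<open>Cancelling the linear factor of \<open>e\<close> from the two factorizations
    shows that \<open>B\<close> has exactly the roots \<open>es\<close>, as the induction hypothesis
    requires.\<close>
  have "[:- e, 1:] * (\<Prod>e\<leftarrow>es. [:- e, 1:]) = char_poly (transpose_mat W * A * W)"
    using orthogonal_similar_char_poly[OF A W] Cons.prems(3) by simp
  also have "\<dots> = char_poly ?E * char_poly B"
    unfolding WAW using B(1) by (intro char_poly_four_block_zeros_col) auto
  finally have "[:- e, 1:] * (\<Prod>e\<leftarrow>es. [:- e, 1:]) = char_poly ?E * char_poly B" .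
  moreover have "char_poly ?E = [:- e, 1:]"
    by (simp add: char_poly_defs det_def sign_def)
  ultimately have "char_poly B = (\<Prod>e\<leftarrow>es. [:- e, 1:])"
    by (metis mult_cancel_left pCons_eq_0_iff zero_neq_one)
  from Cons.IH[OF B this]
  obtain Q where Q: "Q \<in> carrier_mat m m" "transpose_mat Q * Q = 1\<^sub>m m"
    "transpose_mat Q * B * Q = mat_diag m ((!) es)"
    by blast
  \<comment> \<open>\<open>R\<close> fixes the coordinate already split off and diagonalizes the
    block \<open>B\<close>; the product \<open>W * R\<close> is the required orthogonal
    matrix.\<close>
  define R where "R = four_block_mat (1\<^sub>m 1) (0\<^sub>m 1 m) (0\<^sub>m m 1) Q"
  have R: "R \<in> carrier_mat n n"
    using four_block_carrier_mat[OF one_carrier_mat[of 1] Q(1)] by (simp add: R_def n)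
  have Rt: "transpose_mat R = four_block_mat (1\<^sub>m 1) (0\<^sub>m 1 m) (0\<^sub>m m 1) (transpose_mat Q)"
    unfolding R_def using Q by (subst transpose_four_block_mat[of _ 1 1 _ m _ m]) auto
  have "transpose_mat (W * R) * (W * R) = transpose_mat R * (transpose_mat W * W) * R"
    using W(1) R by (simp add: transpose_mult[of _ n n _ n] assoc_mult_mat[of _ n n _ n _ n])
  also have "\<dots> = transpose_mat R * R"
    using W(2) R by simp
  also have "\<dots> = 1\<^sub>m n"
    unfolding Rt unfolding R_def using Q
    by (subst mult_four_block_mat[of _ 1 1 _ m _ m _ _ 1 _ m]) (auto simp: n)
  finally have orth: "transpose_mat (W * R) * (W * R) = 1\<^sub>m n" .
  have "transpose_mat (W * R) * A * (W * R) = transpose_mat R * (transpose_mat W * A * W) * R"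
    using A W(1) R by (simp add: transpose_mult[of _ n n _ n] assoc_mult_mat[of _ n n _ n _ n])
  also have "\<dots> = four_block_mat ?E (0\<^sub>m 1 m) (0\<^sub>m m 1) (transpose_mat Q * B * Q)"
    unfolding WAW Rt unfolding R_def using Q B
    by (simp add: mult_four_block_mat[of _ 1 1 _ m _ m _ _ 1 _ m])
  also have "\<dots> = mat_diag n ((!) (e # es))"
    unfolding Q(3) by (intro eq_matI) (auto simp: mat_diag_def n nth_Cons')
  finally show ?case
    using W(1) R orth by (intro bexI[of _ "W * R"]) auto
qed

section \<open>Comparison of ordered eigenvalues\<close>

text \<open>The sorted list is a rearrangement of any list of roots that splits the polynomial, and
  the product depends only on the multiset of its factors.\<close>

lemma char_poly_eigenvalues_desc:
  assumes A: "A \<in> carrier_mat n n" and sym: "transpose_mat A = A"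
  shows "char_poly A = (\<Prod>e\<leftarrow>eigenvalues_desc A. [:- e, 1:])"
proof -
  obtain es where es: "char_poly A = (\<Prod>e\<leftarrow>es. [:- e, 1:])"
    using symmetric_mat_char_poly_splits[OF A sym] .
  have "proots (\<Prod>e\<leftarrow>es. [:- e, 1::real:]) = mset es"
  proof (induction es)
    case (Cons e es)
    have "(\<Prod>e\<leftarrow>es. [:- e, 1::real:]) \<noteq> 0"
      by (auto simp: prod_list_zero_iff)
    with Cons show ?case
      by (simp add: proots_mult del: mult_pCons_left)
  qed simp
  then have "mset (map (\<lambda>e. [:- e, 1:]) (eigenvalues_desc A)) = mset (map (\<lambda>e. [:- e, 1:]) es)"
    by (simp add: eigenvalues_desc_def es)
  then show ?thesis
    unfolding es by (metis prod_mset_prod_list)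
qed

lemma length_eigenvalues_desc:
  assumes "A \<in> carrier_mat n n" and "transpose_mat A = A"
  shows "length (eigenvalues_desc A) = n"
proof -
  have "degree (\<Prod>e\<leftarrow>es. [:- e, 1::real:]) = length es" for es
    by (induction es) (auto simp: degree_mult_eq prod_list_zero_iff image_iff simp del: mult_pCons_left)
  then show ?thesis
    using char_poly_eigenvalues_desc[OF assms] degree_monic_char_poly[OF assms(1)] by metis
qed

lemma eigenvalues_desc_antimono:
  assumes "i \<le> j" and "j < length (eigenvalues_desc A)"
  shows "eigenvalues_desc A ! j \<le> eigenvalues_desc A ! i"
  using assms unfolding eigenvalues_desc_def by (auto simp: rev_nth intro!: sorted_nth_mono)

text \<open>In coordinates with respect to the columns of \<open>P\<close>, the form of
  \<open>A\<close> becomes a weighted sum of squares and the length is unchanged. Both follow by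
  moving \<open>P\<close> across the scalar product.\<close>

lemma orthogonal_diagonalization_forms:
  fixes A :: "real mat"
  assumes A: "A \<in> carrier_mat n n" and P: "P \<in> carrier_mat n n" "transpose_mat P * P = 1\<^sub>m n"
    and diag: "transpose_mat P * A * P = mat_diag n d" and y: "y \<in> carrier_vec n"
  shows "(P *\<^sub>v y) \<bullet> (A *\<^sub>v (P *\<^sub>v y)) = (\<Sum>i<n. d i * (y $ i)\<^sup>2)"
    and "(P *\<^sub>v y) \<bullet> (P *\<^sub>v y) = (\<Sum>i<n. (y $ i)\<^sup>2)"
proof -
  have move: "(P *\<^sub>v y) \<bullet> z = y \<bullet> (transpose_mat P *\<^sub>v z)" if "z \<in> carrier_vec n" for z
    using transpose_vec_mult_scalar[of "transpose_mat P" n n z y] P(1) y that by simp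
  have "(P *\<^sub>v y) \<bullet> (A *\<^sub>v (P *\<^sub>v y)) = y \<bullet> ((transpose_mat P * A * P) *\<^sub>v y)"
    using A P(1) y by (subst move) (auto simp: assoc_mult_mat_vec[of _ n n _ n])
  also have "\<dots> = (\<Sum>i<n. d i * (y $ i)\<^sup>2)"
    unfolding diag using y
    by (subst scalar_prod_mult_mat_vec_sum[of _ n])
      (auto simp: mat_diag_def if_distrib[of "\<lambda>t. t * _"] if_distrib[of "\<lambda>t. _ * t"] power2_eq_square
        mult_ac intro!: sum.cong cong: if_cong)
  finally show "(P *\<^sub>v y) \<bullet> (A *\<^sub>v (P *\<^sub>v y)) = (\<Sum>i<n. d i * (y $ i)\<^sup>2)" .
  have "(P *\<^sub>v y) \<bullet> (P *\<^sub>v y) = y \<bullet> ((transpose_mat P * P) *\<^sub>v y)"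
    using P(1) y by (subst move) (auto simp: assoc_mult_mat_vec[of _ n n _ n])
  also have "\<dots> = (\<Sum>i<n. (y $ i)\<^sup>2)"
    unfolding P(2) using y by (auto simp: scalar_prod_def power2_eq_square atLeast0LessThan)
  finally show "(P *\<^sub>v y) \<bullet> (P *\<^sub>v y) = (\<Sum>i<n. (y $ i)\<^sup>2)" .
qed

text \<open>The requirements are \<open>n - 1 - k\<close> plus \<open>k\<close> homogeneous linear
  equations in \<open>n\<close> unknowns, so a nonzero solution remains.\<close>

lemma exists_vec_vanishing_blocks:
  fixes M :: "'a :: field mat"
  assumes M: "M \<in> carrier_mat n n" and k: "k < n"
  obtains y where "y \<in> carrier_vec n" "y \<noteq> 0\<^sub>v n" "\<And>i. k < i \<Longrightarrow> i < n \<Longrightarrow> y $ i = 0"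
    "\<And>i. i < k \<Longrightarrow> (M *\<^sub>v y) $ i = 0"
proof -
  \<comment> \<open>All the conditions on \<open>y\<close> form one square system whose \<open>k\<close>-th row is zero.\<close>
  define K where "K = mat\<^sub>r n n (\<lambda>i. if i = k then 0\<^sub>v n else if i < k then row M i else unit_vec n i)"
  have K: "K \<in> carrier_mat n n"
    by (simp add: K_def)
  have "det K = 0"
    unfolding K_def using M k by (intro det_row_0) auto
  then obtain y where y: "y \<in> carrier_vec n" "y \<noteq> 0\<^sub>v n" "K *\<^sub>v y = 0\<^sub>v n"
    using det_0_iff_vec_prod_zero[OF K] by blast
  have Ky: "row K i \<bullet> y = 0" if "i < n" for i
    using y(3) K that by (metis carrier_matD(1) index_mult_mat_vec index_zero_vec(1))
  have row: "row K i = (if i = k then 0\<^sub>v n else if i < k then row M i else unit_vec n i)"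
    if "i < n" for i
    unfolding K_def using M that by (subst row_mat_of_row_fun) auto
  show ?thesis
  proof (rule that[OF y(1,2)])
    show "y $ i = 0" if "k < i" "i < n" for i
      using Ky[of i] row[of i] y(1) that by (simp add: scalar_prod_left_unit)
    show "(M *\<^sub>v y) $ i = 0" if "i < k" for i
      using Ky[of i] row[of i] M k that by simp
  qed
qed

text \<open>
  The span of the first \<open>r\<close> eigenvectors of \<open>B\<close> meets the span of the last \<open>n - r + 1\<close>
  eigenvectors of \<open>A\<close>; the claim is read off from the two quadratic forms at a common vector.
\<close>

theorem eigenvalue_nth_le_affine:
  fixes A B :: "real mat"
  assumes A: "A \<in> carrier_mat n n" "transpose_mat A = A"
    and B: "B \<in> carrier_mat n n" "transpose_mat B = B"
    and le: "\<And>x. x \<in> carrier_vec n \<Longrightarrow> x \<bullet> (B *\<^sub>v x) \<le> a * (x \<bullet> (A *\<^sub>v x)) + c * (x \<bullet> x)"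
    and a: "0 \<le> a" and r: "1 \<le> r" "r \<le> n"
  shows "eigenvalue_nth B r \<le> a * eigenvalue_nth A r + c"
proof -
  \<comment> \<open>List positions start at 0, so the \<open>r\<close>-th largest eigenvalue sits at
    position \<open>k\<close>.\<close>
  define k where "k = r - 1"
  have k: "k < n"
    using r by (simp add: k_def)
  define d where "d = (!) (eigenvalues_desc A)"
  define e where "e = (!) (eigenvalues_desc B)"
  obtain P where P: "P \<in> carrier_mat n n" "transpose_mat P * P = 1\<^sub>m n"
    "transpose_mat P * A * P = mat_diag n d"
    using real_symmetric_spectral[OF A char_poly_eigenvalues_desc[OF A]] by (auto simp: d_def)
  obtain Q where Q: "Q \<in> carrier_mat n n" "transpose_mat Q * Q = 1\<^sub>m n"
    "transpose_mat Q * B * Q = mat_diag n e"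
    using real_symmetric_spectral[OF B char_poly_eigenvalues_desc[OF B]] by (auto simp: e_def)
  \<comment> \<open>\<open>y\<close> holds the coordinates of the common vector \<open>x\<close> in
    the eigenbasis of \<open>B\<close>, and \<open>z\<close> below those in the eigenbasis of
    \<open>A\<close>. The first is supported on indices up to \<open>k\<close>, the second on
    indices from \<open>k\<close> on.\<close>
  obtain y where y: "y \<in> carrier_vec n" "y \<noteq> 0\<^sub>v n" "\<And>i. k < i \<Longrightarrow> i < n \<Longrightarrow> y $ i = 0"
    "\<And>i. i < k \<Longrightarrow> ((transpose_mat P * Q) *\<^sub>v y) $ i = 0"
    using exists_vec_vanishing_blocks[of "transpose_mat P * Q" n k] P(1) Q(1) k by auto
  define x where "x = Q *\<^sub>v y"
  define z where "z = transpose_mat P *\<^sub>v x"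
  have x: "x \<in> carrier_vec n" and z: "z \<in> carrier_vec n"
    using P(1) Q(1) y(1) by (auto simp: x_def z_def)
  have z0: "z $ i = 0" if "i < k" for i
    using y(4)[OF that] P(1) Q(1) y(1) by (simp add: x_def z_def assoc_mult_mat_vec[of _ n n _ n])
  have "P * transpose_mat P = 1\<^sub>m n"
    using mat_mult_left_right_inverse[OF _ P(1) P(2)] P(1) by simp
  then have xz: "P *\<^sub>v z = x"
    using P(1) x by (simp add: z_def assoc_mult_mat_vec[of _ n n _ n, symmetric])
  note forms_A = orthogonal_diagonalization_forms[OF A(1) P z, unfolded xz]
  note forms_B = orthogonal_diagonalization_forms[OF B(1) Q y(1), folded x_def]
  have "e k * (x \<bullet> x) = (\<Sum>i<n. e k * (y $ i)\<^sup>2)"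
    by (simp add: forms_B sum_distrib_left)
  \<comment> \<open>Wherever \<open>y $ i\<close> is nonzero, \<open>i \<le> k\<close>, and the
    descending order gives \<open>e k \<le> e i\<close>.\<close>
  also have "\<dots> \<le> (\<Sum>i<n. e i * (y $ i)\<^sup>2)"
  proof (intro sum_mono)
    fix i assume "i \<in> {..<n}"
    then show "e k * (y $ i)\<^sup>2 \<le> e i * (y $ i)\<^sup>2"
      using y(3)[of i] eigenvalues_desc_antimono[of i k B] length_eigenvalues_desc[OF B] k
      by (cases "k < i") (auto simp: e_def intro!: mult_right_mono)
  qed
  also have "\<dots> = x \<bullet> (B *\<^sub>v x)"
    by (simp add: forms_B)
  also note le[OF x]
  also have "x \<bullet> (A *\<^sub>v x) = (\<Sum>i<n. d i * (z $ i)\<^sup>2)"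
    by (simp add: forms_A)
  \<comment> \<open>Dually, \<open>z $ i\<close> can be nonzero only for \<open>i \<ge> k\<close>,
    where \<open>d i \<le> d k\<close>; the sign of \<open>a\<close> preserves the
    inequality.\<close>
  also have "a * \<dots> + c * (x \<bullet> x) \<le> a * (\<Sum>i<n. d k * (z $ i)\<^sup>2) + c * (x \<bullet> x)"
  proof (intro add_right_mono mult_left_mono[OF _ a] sum_mono)
    fix i assume "i \<in> {..<n}"
    then show "d i * (z $ i)\<^sup>2 \<le> d k * (z $ i)\<^sup>2"
      using z0[of i] eigenvalues_desc_antimono[of k i A] length_eigenvalues_desc[OF A]
      by (cases "i < k") (auto simp: d_def intro!: mult_right_mono)
  qed
  also have "(\<Sum>i<n. d k * (z $ i)\<^sup>2) = d k * (x \<bullet> x)"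
    by (simp add: forms_A sum_distrib_left)
  finally have "e k * (x \<bullet> x) \<le> (a * d k + c) * (x \<bullet> x)"
    by (simp add: algebra_simps)
  \<comment> \<open>Strict positivity permits division by \<open>x \<bullet> x\<close>; it holds
    because \<open>Q\<close> preserves length and \<open>y\<close> is nonzero.\<close>
  moreover have "x \<bullet> x > 0"
  proof -
    have "\<exists>i<n. y $ i \<noteq> 0"
      using y(1,2) by (auto intro: eq_vecI)
    then show ?thesis
      unfolding forms_B(2) by (auto intro!: sum_pos2)
  qed
  ultimately show ?thesis
    by (simp add: eigenvalue_nth_def d_def e_def k_def)
qed

section \<open>Graphs of diameter at most two\<close>

lemma (in wf_digraph) awalk_cost_one: "awalk_cost (\<lambda>_. 1) p = real (length p)"
  by (induction p) auto

lemma (in wf_digraph) graph_dist_le_length: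
  assumes "awalk u p v"
  shows "graph_dist G u v \<le> ereal (length p)"
  unfolding graph_dist_def using min_cost_le_walk_cost[OF assms, of "\<lambda>_. 1"]
  by (simp add: awalk_cost_one)

text \<open>A shortest walk has at most two arcs. The empty walk and the walk along a single arc
  bound its length when \<open>u = v\<close> or when the vertices are adjacent; conversely, a
  shortest walk with one arc makes them adjacent.\<close>

lemma (in graph) graph_dist_le_2:
  assumes u: "u \<in> verts G" and dist: "graph_dist G u v \<le> 2"
  shows "graph_dist G u v = (if u = v then 0 else if u \<rightarrow>\<^bsub>G\<^esub> v then 1 else 2)"
proof -
  \<comment> \<open>A finite distance yields reachability, and hence a walk attaining the
    minimum.\<close>
  have "graph_dist G u v < \<infinity>"
    using dist by (rule order_le_less_trans) simp
  then have "u \<rightarrow>\<^sup>* v"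
    using \<mu>_reach_conv unfolding graph_dist_def by blast
  then obtain p where p: "awalk u p v" and len: "graph_dist G u v = ereal (length p)"
    using min_cost_awalk[of u v "\<lambda>_. 1"] by (auto simp: graph_dist_def awalk_cost_one apath_def)
  have "length p \<le> 2"
    using dist unfolding len by simp
  have self: "length p = 0" if "u = v"
    using graph_dist_le_length[of u "[]" v] u that len by (simp add: awalk_Nil_iff)
  have adj: "length p \<le> 1" if adj: "u \<rightarrow>\<^bsub>G\<^esub> v"
  proof -
    obtain e where "e \<in> arcs G" "tail G e = u" "head G e = v"
      using adj by (auto simp: arcs_ends_conv)
    then have "awalk u [e] v"
      by (auto simp: awalk_Cons_iff awalk_Nil_iff)
    from graph_dist_le_length[OF this] show ?thesis
      by (simp add: len)
  qed
  consider "p = []" | e where "p = [e]" | e f where "p = [e, f]"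
    using \<open>length p \<le> 2\<close> by (cases p; cases "tl p") auto
  then show ?thesis
  proof cases
    case 1
    then show ?thesis
      using p len by (simp add: awalk_Nil_iff)
  next
    case 2
    then have "u \<rightarrow>\<^bsub>G\<^esub> v"
      using p by (auto simp: awalk_Cons_iff awalk_Nil_iff arcs_ends_conv)
    then show ?thesis
      using 2 self len by (auto simp: one_ereal_def)
  next
    case 3
    then show ?thesis
      using self adj len by auto
  qed
qed

lemma graph_dist_le_diameter:
  assumes "u \<in> verts G" and "v \<in> verts G"
  shows "graph_dist G u v \<le> graph_diameter G"
  unfolding graph_diameter_def using assms by (intro SUP_upper2[of "(u, v)"]) auto

lemma adjacency_matrix_carrier: "adjacency_matrix G vs \<in> carrier_mat (length vs) (length vs)"
  by (simp add: adjacency_matrix_def)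

lemma (in graph) transpose_adjacency_matrix:
  "transpose_mat (adjacency_matrix G vs) = adjacency_matrix G vs"
  using arcs_ends_symmetric[OF sym_arcs] by (intro eq_matI) (auto simp: adjacency_matrix_def)

text \<open>Off the diagonal, \<open>1 - 2 * d\<close> is \<open>-1 = 2 - 3\<close> at distance 1
  and \<open>-3\<close> at distance 2. On the diagonal the absence of loops leaves
  \<open>3 - 3 = 0\<close>. Distinctness of \<open>vs\<close> turns equality of vertices into
  equality of indices.\<close>

lemma (in graph) distance_seidel_matrix_diameter_2:
  assumes "distinct vs" and "set vs = verts G" and "graph_diameter G \<le> 2"
  shows "distance_seidel_matrix G vs =
    mat (length vs) (length vs) (\<lambda>(i, j). (if i = j then 3 else 0) - 3 + 2 * adjacency_matrix G vs $$ (i, j))"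
proof -
  have "real_of_ereal (graph_dist G (vs ! i) (vs ! j)) =
      (if i = j then 0 else if vs ! i \<rightarrow>\<^bsub>G\<^esub> vs ! j then 1 else 2)"
    if ij: "i < length vs" "j < length vs" for i j
  proof -
    have "vs ! i \<in> verts G" "vs ! j \<in> verts G"
      using ij assms(2) nth_mem by blast+
    then show ?thesis
      using graph_dist_le_2[of "vs ! i" "vs ! j"] order_trans[OF graph_dist_le_diameter assms(3)] ij
      by (auto simp: nth_eq_iff_index_eq[OF assms(1)])
  qed
  moreover have "\<not> vs ! i \<rightarrow>\<^bsub>G\<^esub> vs ! i" for i
    using adj_not_same by blast
  ultimately show ?thesis
    by (intro eq_matI)
      (auto simp: distance_seidel_matrix_def distance_matrix_def all_ones_matrix_def adjacency_matrix_def)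
qed

section \<open>Quadratic forms involving the all-ones matrix\<close>

lemma affine_all_ones_form:
  fixes A :: "real mat"
  assumes A: "A \<in> carrier_mat n n" and x: "x \<in> carrier_vec n"
  shows "x \<bullet> (mat n n (\<lambda>(i, j). (if i = j then 3 else 0) - 3 + 2 * A $$ (i, j)) *\<^sub>v x) =
    3 * (x \<bullet> x) - 3 * (\<Sum>i<n. x $ i)\<^sup>2 + 2 * (x \<bullet> (A *\<^sub>v x))"
proof -
  have "x \<bullet> (mat n n (\<lambda>(i, j). (if i = j then 3 else 0) - 3 + 2 * A $$ (i, j)) *\<^sub>v x) =
    (\<Sum>i<n. \<Sum>j<n. (if i = j then 3 * (x $ i * x $ j) else 0) - 3 * (x $ i * x $ j)
      + 2 * (x $ i * (A $$ (i, j) * x $ j)))"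
    using x by (subst scalar_prod_mult_mat_vec_sum[of _ n])
      (auto simp: algebra_simps intro!: sum.cong)
  also have "\<dots> = 3 * (\<Sum>i<n. x $ i * x $ i) - 3 * (\<Sum>i<n. \<Sum>j<n. x $ i * x $ j)
      + 2 * (\<Sum>i<n. \<Sum>j<n. x $ i * (A $$ (i, j) * x $ j))"
    by (simp add: sum.distrib sum_subtractf sum_distrib_left)
  \<comment> \<open>This double sum is the quadratic form of the all-ones matrix.\<close>
  also have "(\<Sum>i<n. \<Sum>j<n. x $ i * x $ j) = (\<Sum>i<n. x $ i)\<^sup>2"
    by (simp add: power2_eq_square sum_product)
  also have "(\<Sum>i<n. x $ i * x $ i) = x \<bullet> x"
    using x by (simp add: scalar_prod_def atLeast0LessThan)
  also have "(\<Sum>i<n. \<Sum>j<n. x $ i * (A $$ (i, j) * x $ j)) = x \<bullet> (A *\<^sub>v x)"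
    using A x by (simp add: scalar_prod_mult_mat_vec_sum)
  finally show ?thesis .
qed

text \<open>This is Cauchy-Schwarz against the all-ones vector, obtained by expanding the
  nonnegative sum of all squared differences of entries.\<close>

lemma sum_square_le_scalar_prod:
  fixes x :: "real vec"
  assumes x: "x \<in> carrier_vec n"
  shows "(\<Sum>i<n. x $ i)\<^sup>2 \<le> n * (x \<bullet> x)"
proof -
  have xx: "x \<bullet> x = (\<Sum>i<n. (x $ i)\<^sup>2)"
    using x by (simp add: scalar_prod_def atLeast0LessThan power2_eq_square)
  have prod: "(\<Sum>i<n. \<Sum>j<n. 2 * (x $ i * x $ j)) = 2 * (\<Sum>i<n. x $ i)\<^sup>2"
    by (simp only: power2_eq_square sum_product) (simp only: sum_distrib_left)
  have "0 \<le> (\<Sum>i<n. \<Sum>j<n. (x $ i - x $ j)\<^sup>2)"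
    by (intro sum_nonneg) simp
  also have "\<dots> = (\<Sum>i<n. \<Sum>j<n. (x $ i)\<^sup>2 + (x $ j)\<^sup>2 - 2 * (x $ i * x $ j))"
    by (simp add: power2_diff mult.assoc)
  also have "\<dots> = 2 * (n * (x \<bullet> x)) - 2 * (\<Sum>i<n. x $ i)\<^sup>2"
    by (simp only: xx sum.distrib sum_subtractf prod) (simp add: sum_distrib_left[symmetric])
  finally show ?thesis
    by simp
qed

theorem theorem3p1:
  fixes G :: "('a, 'b) pre_digraph" and vs :: "'a list" and n r :: nat
  assumes "Digraph.graph G"
    and "Digraph_Component.connected G"
    and "distinct vs" and "set vs = verts G"
    and "n = card (verts G)"
    and "graph_diameter G \<le> 2"
    and "1 \<le> r" and "r \<le> n"
  shows "3 - 3 * real n + 2 * eigenvalue_nth (adjacency_matrix G vs) r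
           \<le> eigenvalue_nth (distance_seidel_matrix G vs) r
         \<and> eigenvalue_nth (distance_seidel_matrix G vs) r
           \<le> 3 + 2 * eigenvalue_nth (adjacency_matrix G vs) r"
proof -
  interpret graph G by fact
  have n: "length vs = n"
    using assms(3-5) distinct_card by metis
  define A where "A = adjacency_matrix G vs"
  define S where "S = distance_seidel_matrix G vs"
  have A: "A \<in> carrier_mat n n" "transpose_mat A = A"
    using adjacency_matrix_carrier transpose_adjacency_matrix n by (auto simp: A_def)
  have S_eq: "S = mat n n (\<lambda>(i, j). (if i = j then 3 else 0) - 3 + 2 * A $$ (i, j))"
    using distance_seidel_matrix_diameter_2[OF assms(3,4,6)] n by (simp add: A_def S_def)
  have "A $$ (i, j) = A $$ (j, i)" if "i < n" "j < n" for i j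
    using A that by (metis carrier_matD index_transpose_mat(1))
  then have S: "S \<in> carrier_mat n n" "transpose_mat S = S"
    by (auto simp: S_eq)
  have form: "x \<bullet> (S *\<^sub>v x) = 3 * (x \<bullet> x) - 3 * (\<Sum>i<n. x $ i)\<^sup>2 + 2 * (x \<bullet> (A *\<^sub>v x))"
    if "x \<in> carrier_vec n" for x
    unfolding S_eq by (rule affine_all_ones_form[OF A(1) that])
  \<comment> \<open>For the upper bound, the nonpositive term
    \<open>- 3 * (\<Sum>i<n. x $ i)\<^sup>2\<close> is dropped from the form of
    \<open>S\<close>.\<close>
  have "eigenvalue_nth S r \<le> 2 * eigenvalue_nth A r + 3"
    by (rule eigenvalue_nth_le_affine[OF A S _ _ assms(7,8)]) (simp_all add: form)
  \<comment> \<open>The comparison only bounds from above, so the lower bound comes from exchanging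
    the two matrices: solve \<open>form\<close> for the form of \<open>A\<close> and bound the
    squared sum by \<open>n * (x \<bullet> x)\<close>. Doubling and rearranging gives the constant
    \<open>3 - 3 * n\<close>.\<close>
  moreover have "eigenvalue_nth A r \<le> 1 / 2 * eigenvalue_nth S r + (3 * real n - 3) / 2"
  proof (rule eigenvalue_nth_le_affine[OF S A _ _ assms(7,8)])
    fix x :: "real vec" assume x: "x \<in> carrier_vec n"
    show "x \<bullet> (A *\<^sub>v x) \<le> 1 / 2 * (x \<bullet> (S *\<^sub>v x)) + (3 * real n - 3) / 2 * (x \<bullet> x)"
      using sum_square_le_scalar_prod[OF x] by (simp add: form[OF x] field_simps)
  qed simp
  ultimately show ?thesis
    by (simp add: A_def S_def field_simps)
qed

end
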